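(* Let $\lambda$ be a regular (infinite) cardinal and let $\mathcal{K}$ be a $(\lambda, <\lambda)$-accessible category. If an object $M$ of $\mathcal{K}$ is $\lambda$-presentable, then $M$ is $(<\lambda)$-presentable.
   Context: For a regular cardinal $\lambda$, a poset is $\lambda$-directed if each of its subsets of cardinality strictly less than $\lambda$ has an upper bound. An object $M$ of a category $\mathcal{K}$ is $\lambda$-presentable if $\mathcal{K}(M,-):\mathcal{K}\to\mathbf{Set}$ preserves $\lambda$-directed colimits (colimits of diagrams indexed by $\lambda$-directed posets). For an infinite cardinal $\lambda$, $M$ is $(<\lambda)$-presentable if it is $\lambda_0$-presentable for some regular $\lambda_0 < \lambda + \aleph_1$ (cardinal addition, i.e. the maximum). For infinite cardinals $\mu,\lambda$ with $\mu$ regular, an object is $(\mu,<\lambda)$-resolvable if it is the colimit of a $\mu$-directed system consisting of $(<\lambda)$-presentable objects; a category is $(\mu,<\lambda)$-resolvable if all its objects are. For $\mu\le\lambda$ with $\mu$ regular, a category $\mathcal{K}$ is $(\mu,<\lambda)$-accessible if (1) it has $\mu$-directed colimits, (2) it is $(\mu,<\lambda)$-resolvable, and (3) it has only a set, up to isomorphism, of $(<\lambda)$-presentable objects. *)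

theory Defs
  imports Main "HOL-Library.FuncSet"
begin

unbundle cardinal_syntax

section \<open>Categories, functors and colimits\<close>

text \<open>
  \<open>Comp C g f\<close> is the composite of \<open>f\<close> followed by \<open>g\<close>. All operations are meaningful on the
  carriers \<open>Obj C\<close> and \<open>Arr C\<close> only.
\<close>

record ('o, 'm) cat_data =
  Obj :: "'o set"
  Arr :: "'m set"
  Dom :: "'m \<Rightarrow> 'o"
  Cod :: "'m \<Rightarrow> 'o"
  Id :: "'o \<Rightarrow> 'm"
  Comp :: "'m \<Rightarrow> 'm \<Rightarrow> 'm"

definition Hom :: "('o, 'm) cat_data \<Rightarrow> 'o \<Rightarrow> 'o \<Rightarrow> 'm set" where
  "Hom C a b = {f \<in> Arr C. Dom C f = a \<and> Cod C f = b}"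

locale category =
  fixes C :: "('o, 'm) cat_data"
  assumes Dom_closed: "f \<in> Arr C \<Longrightarrow> Dom C f \<in> Obj C"
    and Cod_closed: "f \<in> Arr C \<Longrightarrow> Cod C f \<in> Obj C"
    and Id_closed: "a \<in> Obj C \<Longrightarrow> Id C a \<in> Hom C a a"
    and Comp_closed: "f \<in> Hom C a b \<Longrightarrow> g \<in> Hom C b c \<Longrightarrow> Comp C g f \<in> Hom C a c"
    and Id_left: "f \<in> Hom C a b \<Longrightarrow> Comp C (Id C b) f = f"
    and Id_right: "f \<in> Hom C a b \<Longrightarrow> Comp C f (Id C a) = f"
    and Comp_assoc: "f \<in> Hom C a b \<Longrightarrow> g \<in> Hom C b c \<Longrightarrow> h \<in> Hom C c d \<Longrightarrow>
      Comp C h (Comp C g f) = Comp C (Comp C h g) f"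

definition isomorphic_objects :: "('o, 'm) cat_data \<Rightarrow> 'o \<Rightarrow> 'o \<Rightarrow> bool" where
  "isomorphic_objects C a b \<longleftrightarrow>
     (\<exists>f \<in> Hom C a b. \<exists>g \<in> Hom C b a. Comp C g f = Id C a \<and> Comp C f g = Id C b)"

record ('o, 'm, 'p, 'n) functor_data =
  FObj :: "'o \<Rightarrow> 'p"
  FArr :: "'m \<Rightarrow> 'n"

definition is_functor ::
  "('o, 'm) cat_data \<Rightarrow> ('p, 'n) cat_data \<Rightarrow> ('o, 'm, 'p, 'n) functor_data \<Rightarrow> bool" where
  "is_functor C D F \<longleftrightarrow>
     category C \<and> category D \<and>
     (\<forall>a \<in> Obj C. FObj F a \<in> Obj D) \<and>
     (\<forall>a b. \<forall>f \<in> Hom C a b. FArr F f \<in> Hom D (FObj F a) (FObj F b)) \<and>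
     (\<forall>a \<in> Obj C. FArr F (Id C a) = Id D (FObj F a)) \<and>
     (\<forall>a b c. \<forall>f \<in> Hom C a b. \<forall>g \<in> Hom C b c.
        FArr F (Comp C g f) = Comp D (FArr F g) (FArr F f))"

definition functor_comp ::
  "('p, 'n, 'q, 'k) functor_data \<Rightarrow> ('o, 'm, 'p, 'n) functor_data \<Rightarrow> ('o, 'm, 'q, 'k) functor_data"
  where
  "functor_comp G F = \<lparr>FObj = FObj G \<circ> FObj F, FArr = FArr G \<circ> FArr F\<rparr>"

definition is_cocone ::
  "('j, 'i) cat_data \<Rightarrow> ('o, 'm) cat_data \<Rightarrow> ('j, 'i, 'o, 'm) functor_data \<Rightarrow> 'o \<Rightarrow> ('j \<Rightarrow> 'm) \<Rightarrow> bool"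
  where
  "is_cocone J C D X c \<longleftrightarrow>
     X \<in> Obj C \<and>
     (\<forall>j \<in> Obj J. c j \<in> Hom C (FObj D j) X) \<and>
     (\<forall>i j. \<forall>u \<in> Hom J i j. Comp C (c j) (FArr D u) = c i)"

definition is_colimit ::
  "('j, 'i) cat_data \<Rightarrow> ('o, 'm) cat_data \<Rightarrow> ('j, 'i, 'o, 'm) functor_data \<Rightarrow> 'o \<Rightarrow> ('j \<Rightarrow> 'm) \<Rightarrow> bool"
  where
  "is_colimit J C D X c \<longleftrightarrow>
     is_cocone J C D X c \<and>
     (\<forall>Y d. is_cocone J C D Y d \<longrightarrow>
        (\<exists>!h. h \<in> Hom C X Y \<and> (\<forall>j \<in> Obj J. Comp C h (c j) = d j)))"

definition preserves_colimits_of ::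
  "('j, 'i) cat_data \<Rightarrow> ('o, 'm) cat_data \<Rightarrow> ('p, 'n) cat_data \<Rightarrow>
   ('j, 'i, 'o, 'm) functor_data \<Rightarrow> ('o, 'm, 'p, 'n) functor_data \<Rightarrow> bool" where
  "preserves_colimits_of J C E D F \<longleftrightarrow>
     (\<forall>X c. is_colimit J C D X c \<longrightarrow>
        is_colimit J E (functor_comp F D) (FObj F X) (\<lambda>j. FArr F (c j)))"


section \<open>Cardinals and smallness\<close>

text \<open>
  The distinction between sets and classes is expressed by a cardinal \<open>\<kappa>\<close> on a type \<open>'v\<close>, which
  plays the role of the universe: a subset of \<open>'v\<close> is \<^emph>\<open>small\<close> (a "set") iff it has fewer than
  \<open>\<kappa>\<close> elements. For strongly inaccessible \<open>\<kappa>\<close> these are, up to bijection, the members of a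
  Grothendieck universe; the definitions do not need \<open>\<kappa>\<close> to be a strong limit.

  Hom-sets, index posets and the sets forming the category of sets are all subsets of \<open>'v\<close>, and
  the cardinals below \<open>\<kappa>\<close> are cardinals on \<open>'v\<close>. As \<open>\<kappa>\<close> itself is a cardinal on \<open>'v\<close>, every set
  of any type with fewer than \<open>\<kappa>\<close> elements has a copy among the small subsets of \<open>'v\<close>. That the
  arrows of a category also have type \<open>'v\<close> is no restriction either, since they may form a proper
  subset of \<open>'v\<close>.
\<close>

definition infinite_cardinal :: "'v rel \<Rightarrow> bool" where
  "infinite_cardinal r \<longleftrightarrow> Card_order r \<and> cinfinite r"

definition regular_cardinal :: "'v rel \<Rightarrow> bool" where
  "regular_cardinal r \<longleftrightarrow> infinite_cardinal r \<and> regularCard r"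

abbreviation aleph_one :: "nat set rel" where
  "aleph_one \<equiv> cardSuc natLeq"

definition small :: "'v rel \<Rightarrow> 'b set \<Rightarrow> bool" where
  "small \<kappa> A \<longleftrightarrow> |A| <o \<kappa>"

definition locally_small :: "'v rel \<Rightarrow> ('o, 'v) cat_data \<Rightarrow> bool" where
  "locally_small \<kappa> C \<longleftrightarrow> (\<forall>a \<in> Obj C. \<forall>b \<in> Obj C. small \<kappa> (Hom C a b))"


section \<open>The category of sets and hom-functors\<close>

text \<open>
  An arrow \<open>A \<rightarrow> B\<close> of the category of small sets is a triple \<open>(A, f, B)\<close> where \<open>f\<close> maps \<open>A\<close> to \<open>B\<close>
  and is \<open>undefined\<close> outside \<open>A\<close>, so that equality of arrows is equality of functions.
\<close>

definition Set_cat :: "'v rel \<Rightarrow> ('v set, 'v set \<times> ('v \<Rightarrow> 'v) \<times> 'v set) cat_data" where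
  "Set_cat \<kappa> =
     \<lparr>Obj = {A. small \<kappa> A},
      Arr = {(A, f, B). small \<kappa> A \<and> small \<kappa> B \<and> f \<in> A \<rightarrow>\<^sub>E B},
      Dom = (\<lambda>(A, f, B). A),
      Cod = (\<lambda>(A, f, B). B),
      Id = (\<lambda>A. (A, restrict (\<lambda>x. x) A, A)),
      Comp = (\<lambda>(B', g, B) (A, f, A'). (A, compose A g f, B))\<rparr>"

definition hom_functor ::
  "('o, 'v) cat_data \<Rightarrow> 'o \<Rightarrow> ('o, 'v, 'v set, 'v set \<times> ('v \<Rightarrow> 'v) \<times> 'v set) functor_data" where
  "hom_functor C M =
     \<lparr>FObj = (\<lambda>N. Hom C M N),
      FArr = (\<lambda>f. (Hom C M (Dom C f), restrict (\<lambda>g. Comp C f g) (Hom C M (Dom C f)),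
                   Hom C M (Cod C f)))\<rparr>"


section \<open>Directed colimits, presentability and accessibility\<close>

text \<open>
  Directedness is required for a small poset \<open>(I, r)\<close>, with \<open>(i, j) \<in> r\<close> meaning \<open>i \<le> j\<close>.
  The empty subset having an upper bound makes \<open>I\<close> nonempty.
\<close>

definition small_directed_poset :: "'v rel \<Rightarrow> 'v rel \<Rightarrow> 'v set \<Rightarrow> 'v rel \<Rightarrow> bool" where
  "small_directed_poset \<kappa> \<mu> I r \<longleftrightarrow>
     small \<kappa> I \<and> partial_order_on I r \<and>
     (\<forall>A. A \<subseteq> I \<and> |A| <o \<mu> \<longrightarrow> (\<exists>u \<in> I. \<forall>a \<in> A. (a, u) \<in> r))"

definition poset_cat :: "'v set \<Rightarrow> 'v rel \<Rightarrow> ('v, 'v \<times> 'v) cat_data" where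
  "poset_cat I r =
     \<lparr>Obj = I, Arr = r, Dom = fst, Cod = snd,
      Id = (\<lambda>i. (i, i)), Comp = (\<lambda>v u. (fst u, snd v))\<rparr>"

definition has_directed_colimits :: "'v rel \<Rightarrow> 'v rel \<Rightarrow> ('o, 'v) cat_data \<Rightarrow> bool" where
  "has_directed_colimits \<kappa> \<mu> K \<longleftrightarrow>
     (\<forall>I r D. small_directed_poset \<kappa> \<mu> I r \<and> is_functor (poset_cat I r) K D \<longrightarrow>
        (\<exists>X c. is_colimit (poset_cat I r) K D X c))"

definition preserves_directed_colimits ::
  "'v rel \<Rightarrow> 'v rel \<Rightarrow> ('o, 'v) cat_data \<Rightarrow> ('p, 'n) cat_data \<Rightarrow> ('o, 'v, 'p, 'n) functor_data \<Rightarrow> bool"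
  where
  "preserves_directed_colimits \<kappa> \<mu> K E F \<longleftrightarrow>
     (\<forall>I r D. small_directed_poset \<kappa> \<mu> I r \<and> is_functor (poset_cat I r) K D \<longrightarrow>
        preserves_colimits_of (poset_cat I r) K E D F)"

definition presentable :: "'v rel \<Rightarrow> 'v rel \<Rightarrow> ('o, 'v) cat_data \<Rightarrow> 'o \<Rightarrow> bool" where
  "presentable \<kappa> \<mu> K M \<longleftrightarrow>
     M \<in> Obj K \<and> preserves_directed_colimits \<kappa> \<mu> K (Set_cat \<kappa>) (hom_functor K M)"

text \<open>
  For infinite \<open>\<theta>\<close>, every cardinal below \<open>\<theta> +c aleph_one\<close> is at most \<open>\<theta>\<close> and hence has a
  representative on the type of \<open>\<theta>\<close>, so the type of \<open>\<theta>\<^sub>0\<close> imposes no restriction.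
\<close>

definition less_presentable :: "'v rel \<Rightarrow> 'v rel \<Rightarrow> ('o, 'v) cat_data \<Rightarrow> 'o \<Rightarrow> bool" where
  "less_presentable \<kappa> \<theta> K M \<longleftrightarrow>
     (\<exists>\<theta>\<^sub>0 :: 'v rel. regular_cardinal \<theta>\<^sub>0 \<and> \<theta>\<^sub>0 <o \<theta> +c aleph_one \<and> presentable \<kappa> \<theta>\<^sub>0 K M)"

definition resolvable_object :: "'v rel \<Rightarrow> 'v rel \<Rightarrow> 'v rel \<Rightarrow> ('o, 'v) cat_data \<Rightarrow> 'o \<Rightarrow> bool" where
  "resolvable_object \<kappa> \<mu> \<theta> K M \<longleftrightarrow>
     (\<exists>I r D c. small_directed_poset \<kappa> \<mu> I r \<and> is_functor (poset_cat I r) K D \<and>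
        (\<forall>i \<in> I. less_presentable \<kappa> \<theta> K (FObj D i)) \<and>
        is_colimit (poset_cat I r) K D M c)"

definition resolvable :: "'v rel \<Rightarrow> 'v rel \<Rightarrow> 'v rel \<Rightarrow> ('o, 'v) cat_data \<Rightarrow> bool" where
  "resolvable \<kappa> \<mu> \<theta> K \<longleftrightarrow> (\<forall>M \<in> Obj K. resolvable_object \<kappa> \<mu> \<theta> K M)"

definition accessible :: "'v rel \<Rightarrow> 'v rel \<Rightarrow> 'v rel \<Rightarrow> ('o, 'v) cat_data \<Rightarrow> bool" where
  "accessible \<kappa> \<mu> \<theta> K \<longleftrightarrow>
     category K \<and> locally_small \<kappa> K \<and>
     regular_cardinal \<mu> \<and> infinite_cardinal \<theta> \<and> \<mu> \<le>o \<theta> \<and>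
     has_directed_colimits \<kappa> \<mu> K \<and>
     resolvable \<kappa> \<mu> \<theta> K \<and>
     (\<exists>S. S \<subseteq> Obj K \<and> small \<kappa> S \<and>
        (\<forall>M. less_presentable \<kappa> \<theta> K M \<longrightarrow> (\<exists>N \<in> S. isomorphic_objects K M N)))"

end

theory Submission
  imports Defs
begin

text \<open>
  Write \<open>M\<close> as a \<open>\<lambda>\<close>-directed colimit of \<open>(<\<lambda>)\<close>-presentable objects. As \<open>M\<close> is
  \<open>\<lambda>\<close>-presentable, its identity factors through one of them, so \<open>M\<close> is a retract of
  a \<open>\<lambda>\<^sub>0\<close>-presentable object for some regular \<open>\<lambda>\<^sub>0\<close> below \<open>max \<lambda> \<aleph>\<^sub>1\<close>. Then
  \<open>K(M, -)\<close> is a retract of a functor preserving \<open>\<lambda>\<^sub>0\<close>-directed colimits, and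
  hence preserves them as well.
\<close>

section \<open>Colimit preservation passes to retracts of functors\<close>

lemma HomD:
  assumes "category C" "f \<in> Hom C a b"
  shows "a \<in> Obj C" "b \<in> Obj C"
  using assms category.Dom_closed[of C f] category.Cod_closed[of C f]
  by (auto simp: Hom_def)

lemma is_functor_cocone:
  assumes F: "is_functor C E F" and D: "is_functor J C D" and c: "is_cocone J C D X c"
  shows "is_cocone J E (functor_comp F D) (FObj F X) (\<lambda>j. FArr F (c j))"
proof -
  have J: "category J"
    using D by (simp add: is_functor_def)
  have "Comp E (FArr F (c j)) (FArr F (FArr D u)) = FArr F (c i)" if u: "u \<in> Hom J i j" for i j u
  proof -
    have "FArr D u \<in> Hom C (FObj D i) (FObj D j)"
      using D u by (auto simp: is_functor_def)
    moreover have "c j \<in> Hom C (FObj D j) X" "Comp C (c j) (FArr D u) = c i"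
      using c u HomD[OF J u] by (auto simp: is_cocone_def)
    ultimately show ?thesis
      using F by (metis is_functor_def)
  qed
  then show ?thesis
    using c F unfolding is_cocone_def is_functor_def functor_comp_def by auto
qed

text \<open>A cocone under \<open>functor_comp F D\<close> becomes one under
  \<open>functor_comp G D\<close> by precomposition with the retraction \<pi>. It then factors
  through \<open>FObj G X\<close>, and precomposing the factor with the section \<sigma> at
  \<open>X\<close> solves the original problem, because \<pi> after \<sigma> is the
  identity.\<close>

lemma preserves_colimits_of_retract:
  assumes F: "is_functor C E F" and G: "is_functor C E G" and D: "is_functor J C D"
    and \<sigma>: "\<And>a. a \<in> Obj C \<Longrightarrow> \<sigma> a \<in> Hom E (FObj F a) (FObj G a)"
    and \<pi>: "\<And>a. a \<in> Obj C \<Longrightarrow> \<pi> a \<in> Hom E (FObj G a) (FObj F a)"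
    and \<sigma>_nat: "\<And>a b f. f \<in> Hom C a b \<Longrightarrow> Comp E (\<sigma> b) (FArr F f) = Comp E (FArr G f) (\<sigma> a)"
    and \<pi>_nat: "\<And>a b f. f \<in> Hom C a b \<Longrightarrow> Comp E (\<pi> b) (FArr G f) = Comp E (FArr F f) (\<pi> a)"
    and \<pi>\<sigma>: "\<And>a. a \<in> Obj C \<Longrightarrow> Comp E (\<pi> a) (\<sigma> a) = Id E (FObj F a)"
    and pres: "preserves_colimits_of J C E D G"
  shows "preserves_colimits_of J C E D F"
  unfolding preserves_colimits_of_def
proof (intro allI impI)
  fix X c
  assume colim: "is_colimit J C D X c"
  interpret E: category E
    using F by (simp add: is_functor_def)
  have J: "category J"
    using D by (simp add: is_functor_def)
  have c: "is_cocone J C D X c"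
    using colim by (simp add: is_colimit_def)
  then have X: "X \<in> Obj C" and c_Hom: "\<And>j. j \<in> Obj J \<Longrightarrow> c j \<in> Hom C (FObj D j) X"
    by (auto simp: is_cocone_def)
  have DO: "FObj D j \<in> Obj C" if "j \<in> Obj J" for j
    using D that by (simp add: is_functor_def)
  have FHom: "FArr F f \<in> Hom E (FObj F a) (FObj F b)"
    and GHom: "FArr G f \<in> Hom E (FObj G a) (FObj G b)" if "f \<in> Hom C a b" for f a b
    using F G that by (auto simp: is_functor_def)
  have Gcolim: "is_colimit J E (functor_comp G D) (FObj G X) (\<lambda>j. FArr G (c j))"
    using pres colim by (simp add: preserves_colimits_of_def)
  show "is_colimit J E (functor_comp F D) (FObj F X) (\<lambda>j. FArr F (c j))"
    unfolding is_colimit_def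
  proof (intro conjI allI impI)
    show "is_cocone J E (functor_comp F D) (FObj F X) (\<lambda>j. FArr F (c j))"
      by (rule is_functor_cocone[OF F D c])
  next
    fix Y d
    assume d: "is_cocone J E (functor_comp F D) Y d"
    then have d_Hom: "\<And>j. j \<in> Obj J \<Longrightarrow> d j \<in> Hom E (FObj F (FObj D j)) Y"
      and d_comp: "\<And>i j u. u \<in> Hom J i j \<Longrightarrow> Comp E (d j) (FArr F (FArr D u)) = d i"
      by (auto simp: is_cocone_def functor_comp_def)
    define d' where "d' j = Comp E (d j) (\<pi> (FObj D j))" for j
    have "Comp E (d' j) (FArr G (FArr D u)) = d' i" if u: "u \<in> Hom J i j" for i j u
    proof -
      have ij: "i \<in> Obj J" "j \<in> Obj J"
        using HomD[OF J u] .
      have Du: "FArr D u \<in> Hom C (FObj D i) (FObj D j)"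
        using D u by (auto simp: is_functor_def)
      have "Comp E (d' j) (FArr G (FArr D u))
          = Comp E (d j) (Comp E (\<pi> (FObj D j)) (FArr G (FArr D u)))"
        unfolding d'_def using E.Comp_assoc[OF GHom[OF Du] \<pi>[OF DO] d_Hom] ij by simp
      \<comment> \<open>Naturality of \<pi> turns the arrow of \<open>G\<close> into one of
        \<open>F\<close>, which the cocone \<open>d\<close> then absorbs.\<close>
      also have "\<dots> = Comp E (Comp E (d j) (FArr F (FArr D u))) (\<pi> (FObj D i))"
        unfolding \<pi>_nat[OF Du] using E.Comp_assoc[OF \<pi>[OF DO] FHom[OF Du] d_Hom] ij by simp
      finally show ?thesis
        unfolding d_comp[OF u] d'_def .
    qed
    then have "is_cocone J E (functor_comp G D) Y d'"
      using d E.Comp_closed[OF \<pi>[OF DO] d_Hom]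
      by (auto simp: is_cocone_def functor_comp_def d'_def)
    then have "\<exists>!h. h \<in> Hom E (FObj G X) Y \<and> (\<forall>j\<in>Obj J. Comp E h (FArr G (c j)) = d' j)"
      using Gcolim by (auto simp: is_colimit_def)
    then obtain h' where h': "h' \<in> Hom E (FObj G X) Y"
      and h'_comp: "\<And>j. j \<in> Obj J \<Longrightarrow> Comp E h' (FArr G (c j)) = d' j"
      and h'_unique: "\<And>k. k \<in> Hom E (FObj G X) Y \<Longrightarrow>
        (\<And>j. j \<in> Obj J \<Longrightarrow> Comp E k (FArr G (c j)) = d' j) \<Longrightarrow> k = h'"
      by (metis (no_types, lifting))
    show "\<exists>!h. h \<in> Hom E (FObj F X) Y \<and> (\<forall>j\<in>Obj J. Comp E h (FArr F (c j)) = d j)"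
    proof (rule ex1I[of _ "Comp E h' (\<sigma> X)"], intro conjI ballI)
      show "Comp E h' (\<sigma> X) \<in> Hom E (FObj F X) Y"
        by (rule E.Comp_closed[OF \<sigma>[OF X] h'])
    next
      fix j
      assume j: "j \<in> Obj J"
      note cj = c_Hom[OF j] and \<sigma>j = \<sigma>[OF DO[OF j]] and \<pi>j = \<pi>[OF DO[OF j]]
      \<comment> \<open>Naturality of \<sigma> brings \<open>h'\<close> next to
        \<open>FArr G (c j)\<close>; their composite \<open>d' j\<close> ends in \<pi>, which
        cancels against \<sigma> and leaves \<open>d j\<close>.\<close>
      have "Comp E (Comp E h' (\<sigma> X)) (FArr F (c j)) = Comp E h' (Comp E (FArr G (c j)) (\<sigma> (FObj D j)))"
        using E.Comp_assoc[OF FHom[OF cj] \<sigma>[OF X] h'] \<sigma>_nat[OF cj] by simp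
      also have "\<dots> = Comp E (d' j) (\<sigma> (FObj D j))"
        using E.Comp_assoc[OF \<sigma>j GHom[OF cj] h'] h'_comp[OF j] by simp
      also have "\<dots> = Comp E (d j) (Id E (FObj F (FObj D j)))"
        unfolding d'_def using E.Comp_assoc[OF \<sigma>j \<pi>j d_Hom[OF j]] \<pi>\<sigma>[OF DO[OF j]] by simp
      also have "\<dots> = d j"
        by (rule E.Id_right[OF d_Hom[OF j]])
      finally show "Comp E (Comp E h' (\<sigma> X)) (FArr F (c j)) = d j" .
    next
      fix k
      assume k: "k \<in> Hom E (FObj F X) Y \<and> (\<forall>j\<in>Obj J. Comp E k (FArr F (c j)) = d j)"
      then have k_Hom: "k \<in> Hom E (FObj F X) Y"
        by simp
      \<comment> \<open>Uniqueness is inherited from \<open>G\<close>: \<open>k\<close> after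
        \<open>\<pi> X\<close> is also a factor of \<open>d'\<close>, hence equals
        \<open>h'\<close>, and composing with \<open>\<sigma> X\<close> recovers
        \<open>k\<close>.\<close>
      have "Comp E k (\<pi> X) = h'"
      proof (rule h'_unique)
        show "Comp E k (\<pi> X) \<in> Hom E (FObj G X) Y"
          by (rule E.Comp_closed[OF \<pi>[OF X] k_Hom])
        fix j
        assume j: "j \<in> Obj J"
        note cj = c_Hom[OF j] and \<pi>j = \<pi>[OF DO[OF j]]
        have "Comp E (Comp E k (\<pi> X)) (FArr G (c j)) = Comp E k (Comp E (FArr F (c j)) (\<pi> (FObj D j)))"
          using E.Comp_assoc[OF GHom[OF cj] \<pi>[OF X] k_Hom] \<pi>_nat[OF cj] by simp
        also have "\<dots> = d' j"
          unfolding d'_def using E.Comp_assoc[OF \<pi>j FHom[OF cj] k_Hom] k j by simp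
        finally show "Comp E (Comp E k (\<pi> X)) (FArr G (c j)) = d' j" .
      qed
      then have "Comp E h' (\<sigma> X) = Comp E k (Id E (FObj F X))"
        using E.Comp_assoc[OF \<sigma>[OF X] \<pi>[OF X] k_Hom] \<pi>\<sigma>[OF X] by simp
      then show "k = Comp E h' (\<sigma> X)"
        using E.Id_right[OF k_Hom] by simp
    qed
  qed
qed

section \<open>The category of small sets\<close>

lemma Hom_Set_cat:
  "Hom (Set_cat \<kappa>) A B = {(A, f, B) | f. small \<kappa> A \<and> small \<kappa> B \<and> f \<in> A \<rightarrow>\<^sub>E B}"
  by (auto simp: Hom_def Set_cat_def)

lemma Comp_Set_cat: "Comp (Set_cat \<kappa>) (B', g, B) (A, f, A') = (A, compose A g f, B)"
  by (simp add: Set_cat_def)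

lemma Obj_Set_cat: "Obj (Set_cat \<kappa>) = {A. small \<kappa> A}"
  by (simp add: Set_cat_def)

lemma Id_Set_cat: "Id (Set_cat \<kappa>) A = (A, restrict (\<lambda>x. x) A, A)"
  by (simp add: Set_cat_def)

lemma category_Set_cat: "category (Set_cat \<kappa>)"
proof
  fix f
  assume "f \<in> Arr (Set_cat \<kappa>)"
  then show "Dom (Set_cat \<kappa>) f \<in> Obj (Set_cat \<kappa>)" "Cod (Set_cat \<kappa>) f \<in> Obj (Set_cat \<kappa>)"
    by (auto simp: Set_cat_def)
next
  fix A
  assume "A \<in> Obj (Set_cat \<kappa>)"
  then show "Id (Set_cat \<kappa>) A \<in> Hom (Set_cat \<kappa>) A A"
    by (auto simp: Hom_Set_cat Obj_Set_cat Id_Set_cat)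
next
  fix f g A B C
  assume "f \<in> Hom (Set_cat \<kappa>) A B" "g \<in> Hom (Set_cat \<kappa>) B C"
  then show "Comp (Set_cat \<kappa>) g f \<in> Hom (Set_cat \<kappa>) A C"
    by (auto simp: Hom_Set_cat Comp_Set_cat compose_def PiE_iff)
next
  fix f A B
  assume "f \<in> Hom (Set_cat \<kappa>) A B"
  then show "Comp (Set_cat \<kappa>) (Id (Set_cat \<kappa>) B) f = f"
    "Comp (Set_cat \<kappa>) f (Id (Set_cat \<kappa>) A) = f"
    \<comment> \<open>Arrows carry extensional functions, so outside \<open>A\<close> both sides are
      \<open>undefined\<close>.\<close>
    by (auto simp: Hom_Set_cat Comp_Set_cat Id_Set_cat compose_def fun_eq_iff PiE_iff extensional_def)
      metis
next
  fix f g h A B C D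
  assume "f \<in> Hom (Set_cat \<kappa>) A B" "g \<in> Hom (Set_cat \<kappa>) B C" "h \<in> Hom (Set_cat \<kappa>) C D"
  then show "Comp (Set_cat \<kappa>) h (Comp (Set_cat \<kappa>) g f) = Comp (Set_cat \<kappa>) (Comp (Set_cat \<kappa>) h g) f"
    by (auto simp: Hom_Set_cat Comp_Set_cat compose_def fun_eq_iff PiE_iff)
qed

text \<open>
  The colimit cocone factors through the union \<open>A\<close> of its images, so by uniqueness the
  composite of the induced map \<open>X \<rightarrow> A\<close> with the inclusion \<open>A \<rightarrow> X\<close> is the identity.
\<close>

lemma Set_colimit_jointly_surjective:
  assumes J: "category J" and colim: "is_colimit J (Set_cat \<kappa>) D X c" and x: "x \<in> X"
  shows "\<exists>j \<in> Obj J. \<exists>y \<in> FObj D j. fst (snd (c j)) y = x"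
proof -
  have cc: "is_cocone J (Set_cat \<kappa>) D X c"
    using colim by (simp add: is_colimit_def)
  define f where "f j = fst (snd (c j))" for j
  define A where "A = (\<Union>j\<in>Obj J. f j ` FObj D j)"
  have cj: "c j = (FObj D j, f j, X)" "small \<kappa> (FObj D j)" "f j \<in> FObj D j \<rightarrow>\<^sub>E X"
    if "j \<in> Obj J" for j
  proof -
    have "c j \<in> Hom (Set_cat \<kappa>) (FObj D j) X"
      using cc that by (simp add: is_cocone_def)
    then show "c j = (FObj D j, f j, X)" "small \<kappa> (FObj D j)" "f j \<in> FObj D j \<rightarrow>\<^sub>E X"
      by (auto simp: Hom_Set_cat f_def)
  qed
  have X: "small \<kappa> X"
    using cc by (simp add: is_cocone_def Obj_Set_cat)
  have AX: "A \<subseteq> X"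
    using cj(3) by (auto simp: A_def PiE_iff)
  have A: "small \<kappa> A"
    using X card_of_mono1[OF AX] unfolding small_def by (rule ordLeq_ordLess_trans[rotated])
  \<comment> \<open>The functions are those of \<open>c\<close>; only the codomain entry of the
    triple shrinks from \<open>X\<close> to \<open>A\<close>.\<close>
  define c' where "c' j = (FObj D j, f j, A)" for j
  have c'_Hom: "c' j \<in> Hom (Set_cat \<kappa>) (FObj D j) A" if "j \<in> Obj J" for j
    using cj[OF that] A that by (auto simp: Hom_Set_cat c'_def A_def PiE_iff)
  have "Comp (Set_cat \<kappa>) (c' j) (FArr D u) = c' i" if u: "u \<in> Hom J i j" for i j u
  proof -
    have "Comp (Set_cat \<kappa>) (c j) (FArr D u) = c i"
      using cc u by (auto simp: is_cocone_def)
    \<comment> \<open>The codomain of a composite is copied from its left factor and does not affect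
      the underlying function, so the equation for \<open>c\<close> carries over to
      \<open>c'\<close>.\<close>
    then show ?thesis
      using cj(1) HomD[OF J u] by (cases "FArr D u") (auto simp: Comp_Set_cat c'_def)
  qed
  with A c'_Hom have "is_cocone J (Set_cat \<kappa>) D A c'"
    by (auto simp: is_cocone_def Obj_Set_cat)
  then obtain h where h: "h \<in> Hom (Set_cat \<kappa>) X A"
    and hc: "\<And>j. j \<in> Obj J \<Longrightarrow> Comp (Set_cat \<kappa>) h (c j) = c' j"
    using colim unfolding is_colimit_def by blast
  from h obtain h0 where h0: "h = (X, h0, A)" "h0 \<in> X \<rightarrow>\<^sub>E A"
    by (auto simp: Hom_Set_cat)
  \<comment> \<open>This arrow is \<open>h\<close> followed by the inclusion of \<open>A\<close>
    into \<open>X\<close>. Like the identity, it factors the cocone \<open>c\<close> through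
    itself.\<close>
  have "(X, h0, X) \<in> Hom (Set_cat \<kappa>) X X"
    using X AX h0 by (auto simp: Hom_Set_cat PiE_iff)
  moreover have "Comp (Set_cat \<kappa>) (X, h0, X) (c j) = c j" if "j \<in> Obj J" for j
    using hc[OF that] cj(1)[OF that] h0 by (simp add: Comp_Set_cat c'_def)
  moreover have "Id (Set_cat \<kappa>) X \<in> Hom (Set_cat \<kappa>) X X"
    using X category.Id_closed[OF category_Set_cat] by (simp add: Obj_Set_cat)
  moreover have "Comp (Set_cat \<kappa>) (Id (Set_cat \<kappa>) X) (c j) = c j" if "j \<in> Obj J" for j
    using cc that unfolding is_cocone_def by (blast intro: category.Id_left[OF category_Set_cat])
  ultimately have "(X, h0, X) = Id (Set_cat \<kappa>) X"
    using colim cc unfolding is_colimit_def by blast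
  then have "h0 x = x"
    using x by (simp add: Id_Set_cat)
  then have "x \<in> A"
    using h0 x by (metis PiE_mem)
  then show ?thesis
    by (auto simp: A_def f_def)
qed

section \<open>Hom-functors and transformations between them\<close>

lemma hom_functor_FArr:
  "f \<in> Hom K a b \<Longrightarrow>
    FArr (hom_functor K M) f = (Hom K M a, restrict (\<lambda>g. Comp K f g) (Hom K M a), Hom K M b)"
  by (auto simp: hom_functor_def Hom_def)

lemma hom_functor_FObj: "FObj (hom_functor K M) a = Hom K M a"
  by (simp add: hom_functor_def)

text \<open>Local smallness puts the hom-sets among the objects of \<open>Set_cat\<close>;
  functoriality is then the left identity law and associativity in \<open>K\<close>.\<close>

lemma is_functor_hom_functor:
  assumes K: "category K" and ls: "locally_small \<kappa> K" and M: "M \<in> Obj K"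
  shows "is_functor K (Set_cat \<kappa>) (hom_functor K M)"
proof -
  interpret category K
    by (rule K)
  have small: "small \<kappa> (Hom K M a)" if "a \<in> Obj K" for a
    using ls M that by (auto simp: locally_small_def)
  show ?thesis
    unfolding is_functor_def
  proof (intro conjI allI ballI)
    fix a
    assume a: "a \<in> Obj K"
    then show "FObj (hom_functor K M) a \<in> Obj (Set_cat \<kappa>)"
      by (simp add: hom_functor_FObj Obj_Set_cat small)
    show "FArr (hom_functor K M) (Id K a) = Id (Set_cat \<kappa>) (FObj (hom_functor K M) a)"
      by (auto simp: hom_functor_FArr[OF Id_closed[OF a]] hom_functor_FObj Id_Set_cat
          fun_eq_iff Id_left)
  next
    fix a b f
    assume f: "f \<in> Hom K a b"
    then show "FArr (hom_functor K M) f
        \<in> Hom (Set_cat \<kappa>) (FObj (hom_functor K M) a) (FObj (hom_functor K M) b)"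
      using HomD[OF K f]
      by (auto simp: hom_functor_FArr[OF f] hom_functor_FObj Hom_Set_cat small intro: Comp_closed)
  next
    fix a b c f g
    assume f: "f \<in> Hom K a b" and g: "g \<in> Hom K b c"
    then show "FArr (hom_functor K M) (Comp K g f)
        = Comp (Set_cat \<kappa>) (FArr (hom_functor K M) g) (FArr (hom_functor K M) f)"
      by (auto simp: hom_functor_FArr[OF f] hom_functor_FArr[OF g]
          hom_functor_FArr[OF Comp_closed[OF f g]] Comp_Set_cat compose_def fun_eq_iff
          Comp_assoc[OF _ f g] Comp_closed[OF _ f])
  qed (auto intro: K category_Set_cat)
qed

text \<open>The component at \<open>a\<close> of the transformation from K(N,-) to K(M,-) that the
  Yoneda embedding assigns to \<open>s\<close>, for an arrow \<open>s\<close> from \<open>M\<close>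
  to \<open>N\<close>.\<close>

definition precomp :: "('o, 'v) cat_data \<Rightarrow> 'o \<Rightarrow> 'o \<Rightarrow> 'v \<Rightarrow> 'o \<Rightarrow> 'v set \<times> ('v \<Rightarrow> 'v) \<times> 'v set"
  where
  "precomp K M N s a = (Hom K N a, restrict (\<lambda>g. Comp K g s) (Hom K N a), Hom K M a)"

lemma precomp_Hom:
  assumes K: "category K" and ls: "locally_small \<kappa> K" and s: "s \<in> Hom K M N" and a: "a \<in> Obj K"
  shows "precomp K M N s a
    \<in> Hom (Set_cat \<kappa>) (FObj (hom_functor K N) a) (FObj (hom_functor K M) a)"
  using ls a HomD[OF K s] category.Comp_closed[OF K s]
  by (auto simp: precomp_def Hom_Set_cat hom_functor_FObj locally_small_def)

text \<open>Both sides send \<open>g\<close> to the composite of \<open>s\<close>, \<open>g\<close>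
  and \<open>f\<close>, so naturality is associativity.\<close>

lemma precomp_natural:
  assumes K: "category K" and s: "s \<in> Hom K M N" and f: "f \<in> Hom K a b"
  shows "Comp (Set_cat \<kappa>) (precomp K M N s b) (FArr (hom_functor K N) f)
    = Comp (Set_cat \<kappa>) (FArr (hom_functor K M) f) (precomp K M N s a)"
  using category.Comp_closed[OF K s] category.Comp_closed[OF K _ f] category.Comp_assoc[OF K s _ f]
  by (auto simp: precomp_def hom_functor_FArr[OF f] Comp_Set_cat compose_def fun_eq_iff)

text \<open>Associativity turns (g p) s into g (p s) = g. Thus a retract \<open>M\<close> of
  \<open>N\<close> makes K(M,-) a retract of K(N,-).\<close>

lemma precomp_retract:
  assumes K: "category K" and s: "s \<in> Hom K M N" and p: "p \<in> Hom K N M"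
    and ps: "Comp K p s = Id K M"
  shows "Comp (Set_cat \<kappa>) (precomp K M N s a) (precomp K N M p a)
    = Id (Set_cat \<kappa>) (FObj (hom_functor K M) a)"
  using category.Comp_closed[OF K p] category.Comp_assoc[OF K s p] category.Id_right[OF K] ps
  by (auto simp: precomp_def Comp_Set_cat Id_Set_cat hom_functor_FObj compose_def fun_eq_iff)

section \<open>Presentable objects, retracts and splittings\<close>

lemma presentable_retract:
  assumes K: "category K" and ls: "locally_small \<kappa> K"
    and s: "s \<in> Hom K M N" and p: "p \<in> Hom K N M" and ps: "Comp K p s = Id K M"
    and N: "presentable \<kappa> \<mu> K N"
  shows "presentable \<kappa> \<mu> K M"
  unfolding presentable_def preserves_directed_colimits_def
proof (intro conjI allI impI)
  show M: "M \<in> Obj K"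
    by (rule HomD[OF K s])
  fix I r D
  assume D: "small_directed_poset \<kappa> \<mu> I r \<and> is_functor (poset_cat I r) K D"
  then have "preserves_colimits_of (poset_cat I r) K (Set_cat \<kappa>) D (hom_functor K N)"
    using N by (simp add: presentable_def preserves_directed_colimits_def)
  with D show "preserves_colimits_of (poset_cat I r) K (Set_cat \<kappa>) D (hom_functor K M)"
    \<comment> \<open>Contravariance exchanges the roles: \<sigma> is precomposition with the
      retraction \<open>p\<close>, and \<pi> is precomposition with the section
      \<open>s\<close>.\<close>
    using preserves_colimits_of_retract[OF is_functor_hom_functor[OF K ls M]
        is_functor_hom_functor[OF K ls HomD(2)[OF K s]] _
        precomp_Hom[OF K ls p] precomp_Hom[OF K ls s]
        precomp_natural[OF K p] precomp_natural[OF K s] precomp_retract[OF K s p ps]]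
    by blast
qed

text \<open>K(M,-) sends the colimit cocone on \<open>M\<close> to a jointly surjective cocone on
  K(M,M). A preimage \<open>s\<close> of the identity in some K(M, D i) is the required
  splitting.\<close>

lemma directed_colimit_presentable_split:
  assumes K: "category K" and M: "presentable \<kappa> \<mu> K M"
    and I: "small_directed_poset \<kappa> \<mu> I r" and D: "is_functor (poset_cat I r) K D"
    and colim: "is_colimit (poset_cat I r) K D M c"
  shows "\<exists>i \<in> I. \<exists>s \<in> Hom K M (FObj D i). Comp K (c i) s = Id K M"
proof -
  let ?J = "poset_cat I r"
  have M_Obj: "M \<in> Obj K"
    using M by (simp add: presentable_def)
  have "is_colimit ?J (Set_cat \<kappa>) (functor_comp (hom_functor K M) D)
      (FObj (hom_functor K M) M) (\<lambda>j. FArr (hom_functor K M) (c j))"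
    using M I D colim
    by (auto simp: presentable_def preserves_directed_colimits_def preserves_colimits_of_def)
  moreover have "Id K M \<in> FObj (hom_functor K M) M"
    using category.Id_closed[OF K M_Obj] by (simp add: hom_functor_FObj)
  moreover have "category ?J"
    using D by (simp add: is_functor_def)
  ultimately obtain i s where i: "i \<in> Obj ?J" and s: "s \<in> Hom K M (FObj D i)"
    and eq: "fst (snd (FArr (hom_functor K M) (c i))) s = Id K M"
    by (fastforce dest: Set_colimit_jointly_surjective simp: functor_comp_def hom_functor_FObj)
  have "c i \<in> Hom K (FObj D i) M"
    using colim i by (auto simp: is_colimit_def is_cocone_def)
  then have "Comp K (c i) s = Id K M"
    using eq s by (simp add: hom_functor_FArr)
  then show ?thesis
    using i s by (auto simp: poset_cat_def)
qed

theorem theorem3p10: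
  fixes \<kappa> \<theta> :: "'v rel" and K :: "('o, 'v) cat_data" and M :: 'o
  assumes "regular_cardinal \<kappa>"
    and "regular_cardinal \<theta>" and "\<theta> <o \<kappa>"
    and "accessible \<kappa> \<theta> \<theta> K"
    and "M \<in> Obj K"
    and "presentable \<kappa> \<theta> K M"
  shows "less_presentable \<kappa> \<theta> K M"
proof -
  have K: "category K" and ls: "locally_small \<kappa> K" and "resolvable_object \<kappa> \<theta> \<theta> K M"
    using assms(4,5) by (auto simp: accessible_def resolvable_def)
  then obtain I r D c where I: "small_directed_poset \<kappa> \<theta> I r"
    and D: "is_functor (poset_cat I r) K D"
    and lp: "\<And>i. i \<in> I \<Longrightarrow> less_presentable \<kappa> \<theta> K (FObj D i)"
    and colim: "is_colimit (poset_cat I r) K D M c"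
    unfolding resolvable_object_def by blast
  obtain i s where i: "i \<in> I" and s: "s \<in> Hom K M (FObj D i)" and cs: "Comp K (c i) s = Id K M"
    using directed_colimit_presentable_split[OF K assms(6) I D colim] by blast
  have "c i \<in> Hom K (FObj D i) M"
    using colim i by (auto simp: is_colimit_def is_cocone_def poset_cat_def)
  \<comment> \<open>The regular cardinal witnessing that \<open>FObj D i\<close> is
    (<\<theta>)-presentable serves for \<open>M\<close> as well, since passing to a retract keeps
    the cardinal fixed.\<close>
  then show ?thesis
    using lp[OF i] presentable_retract[OF K ls s _ cs] unfolding less_presentable_def by blast
qed

end
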